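(* Let $\alpha,\beta,\gamma>0$ and $0<c<1$, and let $(x_n)_{n\ge 0}$, $(y_n)_{n\ge 0}$ be the sequences attached to the hypergeometric weights $w_k=\frac{(\alpha)_k(\beta)_k}{(\gamma)_k\,k!}c^k$ as defined in the context. Then the sequences $(x_n,y_n)$ can be computed recursively using, for $n\ge 0$, $$\big(y_n-\alpha\beta+(\alpha+\beta+n)x_n-x_n^2\big)\big(y_{n+1}-\alpha\beta+(\alpha+\beta+n+1)x_n-x_n^2\big)=\frac1c (x_n-1)(x_n-\alpha)(x_n-\beta)(x_n-\gamma),$$ and, for $n\ge 1$, $$(x_n+Y_n)(x_{n-1}+Y_n)=\frac{(y_n+n\alpha)(y_n+n\beta)\big(y_n+n\gamma-(\gamma-\alpha)(\gamma-\beta)\big)\big(y_n+n-(1-\alpha)(1-\beta)\big)}{\Big(y_n(2n+\alpha+\beta-\gamma-1)+n\big((n+\alpha+\beta)(n+\alpha+\beta-\gamma-1)-\alpha\beta+\gamma\big)\Big)^2},$$ where $$Y_n=\frac{y_n^2+y_n\big(n(n+\alpha+\beta-\gamma-1)-\alpha\beta+\gamma\big)-\alpha\beta\, n(n+\alpha+\beta-\gamma-1)}{y_n(2n+\alpha+\beta-\gamma-1)+n\big((n+\alpha+\beta)(n+\alpha+\beta-\gamma-1)-\alpha\beta+\gamma\big)}.$$ The initial values are given by $$y_0=0,\qquad x_0=\frac{c\alpha\beta}{\gamma}\,\frac{{}_2F_1(\alpha+1,\beta+1;\gamma+1;c)}{{}_2F_1(\alpha,\beta;\gamma;c)}-\f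rac{(\alpha+\beta)c-\gamma}{1-c}.$$
   Context: Here $(a)_k=a(a+1)\cdots(a+k-1)$ is the Pochhammer symbol and ${}_2F_1$ is the Gauss hypergeometric function. Let $\alpha,\beta,\gamma>0$, $0<c<1$, and $w_k=\frac{(\alpha)_k(\beta)_k}{(\gamma)_k\,k!}c^k$ for $k\in\mathbb N=\{0,1,2,\dots\}$. Let $(p_n)_{n\ge0}$ be the orthonormal polynomials, $p_n$ of degree $n$ with positive leading coefficient, $\sum_{k=0}^\infty p_n(k)p_m(k)w_k=\delta_{m,n}$. They satisfy a three-term recurrence $xp_n(x)=a_{n+1}p_{n+1}(x)+b_np_n(x)+a_np_{n-1}(x)$ with $a_0=0$, $a_n>0$ for $n\ge1$ (and $p_{-1}=0$). The discrete potential is $$u(x)=-1+\frac{(\gamma+x-1)x}{c(\alpha+x-1)(\beta+x-1)},$$ with the convention $u(0)=-1$. Define, as rational functions of $x$, $$\frac{A_n(x)}{a_n}:=\sum_{k=0}^\infty p_n(k)p_n(k-1)\frac{u(x+1)-u(k)}{x+1-k}\,w_k,\qquad B_n(x):=a_n\sum_{k=0}^\infty p_n(k)p_{n-1}(k-1)\frac{u(x+1)-u(k)}{x+1-k}\,w_k$$ (the first formula is the definition of the symbol $A_n/a_n$ also for $n=0$; and $B_0=0$). The sequences $x_n,y_n$ are the numbers determined by $$\frac{A_n(x)}{a_n}=\frac{1-c}{c}\,\frac{x+x_n}{(x+\alpha)(x+\beta)},\qquad B_n(x)=\frac{-nx+y_n}{(x+\alpha)(x+\beta)}.$$ When $\alpha\neq\beta$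 and $\frac{A_n(x)}{a_n}=\frac{u_n}{x+\alpha}+\frac{v_n}{x+\beta}$, $B_n(x)=\frac{r_n}{x+\alpha}+\frac{s_n}{x+\beta}$, this means $x_n=\frac{c}{1-c}(\beta u_n+\alpha v_n)$ and $y_n=\beta r_n+\alpha s_n$.
   Formalization: The second recurrence is stated for those n ≥ 1 at which the denominator of Y_n is nonzero; it vanishes for isolated parameters (e.g. α=1.3, β=0.7, c=0.3, γ≈1.4775, n=1), where Y_n is undefined. *)

theory Defs
  imports "HOL-Analysis.Analysis" "HOL-Computational_Algebra.Polynomial"
begin

definition hyp2F1 :: "real \<Rightarrow> real \<Rightarrow> real \<Rightarrow> real \<Rightarrow> real" where
  "hyp2F1 a b c z =
     (\<Sum>k. pochhammer a k * pochhammer b k / (pochhammer c k * fact k) * z ^ k)"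

definition hg_weight :: "real \<Rightarrow> real \<Rightarrow> real \<Rightarrow> real \<Rightarrow> nat \<Rightarrow> real" where
  "hg_weight \<alpha> \<beta> \<gamma> c k =
     pochhammer \<alpha> k * pochhammer \<beta> k / (pochhammer \<gamma> k * fact k) * c ^ k"

definition orthonormal_polys :: "(nat \<Rightarrow> real) \<Rightarrow> (nat \<Rightarrow> real poly) \<Rightarrow> bool" where
  "orthonormal_polys w p \<longleftrightarrow>
     (\<forall>n. degree (p n) = n \<and> lead_coeff (p n) > 0) \<and>
     (\<forall>m n. (\<lambda>k. poly (p n) (real k) * poly (p m) (real k) * w k)
               sums (if m = n then 1 else 0))"

definition three_term_recurrence ::
  "(nat \<Rightarrow> real poly) \<Rightarrow> (nat \<Rightarrow> real) \<Rightarrow> (nat \<Rightarrow> real) \<Rightarrow> bool" where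
  "three_term_recurrence p a b \<longleftrightarrow>
     a 0 = 0 \<and> (\<forall>n\<ge>1. a n > 0) \<and>
     (\<forall>n. [:0, 1:] * p n =
        smult (a (n + 1)) (p (n + 1)) + smult (b n) (p n)
        + (if n = 0 then 0 else smult (a n) (p (n - 1))))"

text \<open>Since division by zero yields zero, the convention \<open>u(0) = -1\<close> holds here
  also if \<open>\<alpha> = 1\<close> or \<open>\<beta> = 1\<close>.\<close>

definition hg_potential :: "real \<Rightarrow> real \<Rightarrow> real \<Rightarrow> real \<Rightarrow> real \<Rightarrow> real" where
  "hg_potential \<alpha> \<beta> \<gamma> c x =
     -1 + (\<gamma> + x - 1) * x / (c * (\<alpha> + x - 1) * (\<beta> + x - 1))"

text \<open>The values of the rational functions \<open>A\<^sub>n / a\<^sub>n\<close> and \<open>B\<^sub>n\<close> at a point \<open>x\<close>. The term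
  \<open>p n (k - 1)\<close> is the polynomial at the real number \<open>k - 1\<close>, which is \<open>-1\<close> for \<open>k = 0\<close>.\<close>

definition ladder_A_over_a ::
  "(nat \<Rightarrow> real) \<Rightarrow> (real \<Rightarrow> real) \<Rightarrow> (nat \<Rightarrow> real poly) \<Rightarrow> nat \<Rightarrow> real \<Rightarrow> real" where
  "ladder_A_over_a w u p n x =
     (\<Sum>k. poly (p n) (real k) * poly (p n) (real k - 1)
           * ((u (x + 1) - u (real k)) / (x + 1 - real k)) * w k)"

definition ladder_B ::
  "(nat \<Rightarrow> real) \<Rightarrow> (real \<Rightarrow> real) \<Rightarrow> (nat \<Rightarrow> real poly) \<Rightarrow> (nat \<Rightarrow> real) \<Rightarrow> nat \<Rightarrow> real \<Rightarrow> real" where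
  "ladder_B w u p a n x =
     (if n = 0 then 0
      else a n * (\<Sum>k. poly (p n) (real k) * poly (p (n - 1)) (real k - 1)
           * ((u (x + 1) - u (real k)) / (x + 1 - real k)) * w k))"

text \<open>The points at which the defining series can be evaluated literally: the poles \<open>-\<alpha>\<close>, \<open>-\<beta>\<close>
  and the removable singularities \<open>k - 1\<close> of the difference quotients are left out. This set is
  infinite, so two rational functions that agree on it are equal.\<close>

definition regular_points :: "real \<Rightarrow> real \<Rightarrow> real set" where
  "regular_points \<alpha> \<beta> = {x. x \<noteq> - \<alpha> \<and> x \<noteq> - \<beta> \<and> (\<forall>k::nat. x + 1 \<noteq> real k)}"

definition hg_x ::
  "real \<Rightarrow> real \<Rightarrow> real \<Rightarrow> real \<Rightarrow> (nat \<Rightarrow> real poly) \<Rightarrow> nat \<Rightarrow> real" where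
  "hg_x \<alpha> \<beta> \<gamma> c p n =
     (THE \<xi>. \<forall>x\<in>regular_points \<alpha> \<beta>.
        ladder_A_over_a (hg_weight \<alpha> \<beta> \<gamma> c) (hg_potential \<alpha> \<beta> \<gamma> c) p n x =
          (1 - c) / c * ((x + \<xi>) / ((x + \<alpha>) * (x + \<beta>))))"

definition hg_y ::
  "real \<Rightarrow> real \<Rightarrow> real \<Rightarrow> real \<Rightarrow> (nat \<Rightarrow> real poly) \<Rightarrow> (nat \<Rightarrow> real) \<Rightarrow> nat \<Rightarrow> real" where
  "hg_y \<alpha> \<beta> \<gamma> c p a n =
     (THE \<eta>. \<forall>x\<in>regular_points \<alpha> \<beta>.
        ladder_B (hg_weight \<alpha> \<beta> \<gamma> c) (hg_potential \<alpha> \<beta> \<gamma> c) p a n x =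
          (- real n * x + \<eta>) / ((x + \<alpha>) * (x + \<beta>)))"

text \<open>\<open>Y\<^sub>n\<close> is the quotient \<open>Y_num / Y_den\<close> below, evaluated at \<open>y = y\<^sub>n\<close>; the square of the same
  denominator occurs in the recurrence.\<close>

definition Y_num :: "real \<Rightarrow> real \<Rightarrow> real \<Rightarrow> nat \<Rightarrow> real \<Rightarrow> real" where
  "Y_num \<alpha> \<beta> \<gamma> n y =
     y\<^sup>2 + y * (real n * (real n + \<alpha> + \<beta> - \<gamma> - 1) - \<alpha> * \<beta> + \<gamma>)
     - \<alpha> * \<beta> * real n * (real n + \<alpha> + \<beta> - \<gamma> - 1)"

definition Y_den :: "real \<Rightarrow> real \<Rightarrow> real \<Rightarrow> nat \<Rightarrow> real \<Rightarrow> real" where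
  "Y_den \<alpha> \<beta> \<gamma> n y =
     y * (2 * real n + \<alpha> + \<beta> - \<gamma> - 1)
     + real n * ((real n + \<alpha> + \<beta>) * (real n + \<alpha> + \<beta> - \<gamma> - 1) - \<alpha> * \<beta> + \<gamma>)"

end

theory Submission
  imports Defs
begin

text \<open>
  Let \<open>L f = (\<Sum>k. f(k) w\<^sub>k)\<close> on polynomials. The Pearson equation of the weights turns the series for
  \<open>A\<^sub>n/a\<^sub>n\<close> and \<open>B\<^sub>n\<close>, multiplied by \<open>D(x) = (x + \<alpha>)(x + \<beta>)\<close>, into values of \<open>L\<close>, so that they are
  linear in \<open>x\<close>. Christoffel-Darboux then gives a matrix \<open>M(x)\<close> that maps \<open>(p\<^sub>n\<^sub>+\<^sub>1, p\<^sub>n)(x)\<close> to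
  \<open>(p\<^sub>n\<^sub>+\<^sub>1, p\<^sub>n)(x + 1)\<close>. The same computation for the step from \<open>x + 1\<close> back to \<open>x\<close> yields a multiple
  of the adjugate of \<open>M(x)\<close>, whence \<open>D(x) det M(x) = (x + 1)(x + \<gamma>)/c\<close>. At the zero \<open>x = -x\<^sub>n\<close> of \<open>A\<^sub>n\<close> the
  matrix is triangular and the determinant identity is the first recurrence; eliminating the
  other unknowns from its coefficients gives the second one.
\<close>

section \<open>Shifted polynomials and bases graded by degree\<close>

abbreviation shift :: "real \<Rightarrow> real poly \<Rightarrow> real poly" where
  "shift h q \<equiv> pcompose q [:h, 1:]"

lemma poly_shift: "poly (shift h q) x = poly q (x + h)"
  by (simp add: poly_pcompose algebra_simps)

lemma shift_shift: "shift h (shift k q) = shift (h + k) q"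
  by (rule poly_ext) (simp add: poly_shift ac_simps)

lemma shift_zero: "shift 0 q = q"
  by (rule poly_ext) (simp add: poly_shift)

text \<open>The induction subtracts the multiple of \<open>p n\<close> that cancels coefficient
  \<open>n\<close>. Bounding coefficients instead of the degree lets \<open>n = 0\<close> mean
  \<open>q = 0\<close>.\<close>

lemma poly_span:
  fixes p :: "nat \<Rightarrow> real poly"
  assumes "\<And>n. degree (p n) = n" and "\<And>n. lead_coeff (p n) \<noteq> 0"
    and "\<forall>i\<ge>n. coeff q i = 0"
  shows "\<exists>d. q = (\<Sum>j<n. smult (d j) (p j))"
  using assms(3)
proof (induction n arbitrary: q)
  case 0
  then have "q = 0" by (simp add: poly_eq_iff)
  then show ?case by simp
next
  case (Suc n)
  define e where "e = coeff q n / lead_coeff (p n)"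
  have "coeff (q - smult e (p n)) i = 0" if "i \<ge> n" for i
  proof (cases "i = n")
    case True
    then show ?thesis using assms(1)[of n] assms(2)[of n] by (simp add: e_def)
  next
    case False
    with that have "coeff (p n) i = 0" using assms(1)[of n] by (intro coeff_eq_0) simp
    then show ?thesis using Suc.prems that False by simp
  qed
  then obtain d where d: "q - smult e (p n) = (\<Sum>j<n. smult (d j) (p j))"
    using Suc.IH by blast
  have "q = (\<Sum>j<n. smult (d j) (p j)) + smult e (p n)"
    using d by (simp add: algebra_simps)
  also have "\<dots> = (\<Sum>j<Suc n. smult ((d(n := e)) j) (p j))"
    by simp
  finally show ?case by blast
qed

lemma poly_span_degree:
  fixes p :: "nat \<Rightarrow> real poly"
  assumes "\<And>n. degree (p n) = n" and "\<And>n. lead_coeff (p n) \<noteq> 0" and "degree q < n"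
  shows "\<exists>d. q = (\<Sum>j<n. smult (d j) (p j))"
  using assms by (intro poly_span) (auto intro: coeff_eq_0)

section \<open>Orthonormal polynomials for an abstract functional\<close>

text \<open>Separates the algebra from convergence. The assumption \<open>pearson\<close> is the
  relation \<open>k (k + \<gamma> - 1) w k = c (k + \<alpha> - 1) (k + \<beta> - 1) w (k -
  1)\<close>, summed against \<open>f\<close> with an index shift on the right.\<close>

locale pearson_functional =
  fixes \<alpha> \<beta> \<gamma> c :: real and p :: "nat \<Rightarrow> real poly" and a b :: "nat \<Rightarrow> real"
    and L :: "real poly \<Rightarrow> real"
  assumes c: "c \<noteq> 0" "c \<noteq> 1"
    and L_add: "L (f + g) = L f + L g"
    and L_smult: "L (smult r f) = r * L f"
    and pearson: "L ([:0, \<gamma> - 1, 1:] * f) = c * L ([:\<alpha>, 1:] * [:\<beta>, 1:] * shift 1 f)"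
    and orth: "L (p n * p m) = (if m = n then 1 else 0)"
    and degree_p: "degree (p n) = n"
    and lead_p: "lead_coeff (p n) > 0"
    and recurrence: "three_term_recurrence p a b"
begin

lemma L_0 [simp]: "L 0 = 0"
  using L_smult[of 0 0] by simp

lemma L_diff: "L (f - g) = L f - L g"
  using L_add[of f "smult (-1) g"] L_smult[of "-1" g] by simp

lemma L_sum: "L (sum f I) = (\<Sum>i\<in>I. L (f i))"
  by (induction I rule: infinite_finite_induct) (auto simp: L_add)

lemma span: "degree q < n \<Longrightarrow> \<exists>d. q = (\<Sum>j<n. smult (d j) (p j))"
  using degree_p lead_p by (intro poly_span_degree) (auto simp: less_imp_neq[symmetric])

lemma orth_low:
  assumes "degree q < n"
  shows "L (p n * q) = 0" "L (q * p n) = 0"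
proof -
  obtain d where q: "q = (\<Sum>j<n. smult (d j) (p j))" using span[OF assms] by blast
  show "L (p n * q) = 0"
    by (simp add: q sum_distrib_left L_sum L_smult orth)
  then show "L (q * p n) = 0" by (simp add: mult.commute)
qed

lemma degree_shift [simp]: "degree (shift h q) = degree q"
  by (simp add: degree_pcompose)

text \<open>A shift keeps the leading coefficient, so \<open>shift h (p n) - p n\<close> has degree
  below \<open>n\<close> and is orthogonal to \<open>p n\<close>. For \<open>n = 0\<close> no
  smaller degree exists, hence the separate case.\<close>

lemma orth_shift: "L (shift h (p n) * p n) = 1"
proof (cases "n = 0")
  case True
  then obtain k where "p n = [:k:]" using degree_p[of n] degree_0_id by metis
  then show ?thesis using orth[of n n] by simp
next
  case False
  have "coeff (shift h (p n)) n = coeff (p n) n"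
    using lead_coeff_comp[of "[:h, 1:]" "p n"] degree_p[of n] by simp
  then have "degree (shift h (p n) - p n) < n"
    using degree_p[of n] False coeff_eq_0[of "p n"] coeff_eq_0[of "shift h (p n)"]
    by (intro degree_lessI) (auto simp: le_less)
  then have "L ((shift h (p n) - p n) * p n) = 0" by (rule orth_low)
  then show ?thesis by (simp add: left_diff_distrib L_diff orth)
qed

lemma orth_shift': "L (p n * shift h (p n)) = 1"
  using orth_shift by (simp add: mult.commute)

text \<open>Absorbs the factor \<open>a n\<close> and the case \<open>n = 0\<close>, so that the
  recurrence and the ladder formulas are uniform in \<open>n\<close>.\<close>

definition prev :: "nat \<Rightarrow> real poly" where
  "prev n = (if n = 0 then 0 else smult (a n) (p (n - 1)))"

lemma prev_simps [simp]: "prev 0 = 0" "prev (Suc n) = smult (a (Suc n)) (p n)"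
  by (auto simp: prev_def)

lemma rec: "[:0, 1:] * p n = smult (a (Suc n)) (p (Suc n)) + smult (b n) (p n) + prev n"
  using recurrence unfolding three_term_recurrence_def prev_def by simp

lemma rec_poly:
  "x * poly (p n) x = a (Suc n) * poly (p (Suc n)) x + b n * poly (p n) x + poly (prev n) x"
  using arg_cong[OF rec[of n], of "\<lambda>q. poly q x"] by simp

lemma orth_shift_prev: "L (p n * shift h (prev n)) = 0"
  by (cases n) (simp_all add: pcompose_smult L_smult orth_low degree_p)

lemma orth_shift_prev': "L (shift h (prev n) * p n) = 0"
  using orth_shift_prev by (simp add: mult.commute)

text \<open>Evaluating the functional at \<open>(y + 1) p_n(y + 1) p_n(y)\<close> by the recurrence
  at \<open>y + 1\<close>, and again at \<open>y\<close>, shows that the value grows by 1 in each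
  step. Its negative becomes the slope of \<open>B n\<close>.\<close>

lemma shift_prev: "L (shift 1 (p n) * prev n) = real n"
proof (induction n)
  case (Suc n)
  have 1: "shift 1 ([:0, 1:] * p n) * p n = shift 1 (p n) * ([:0, 1:] * p n) + shift 1 (p n) * p n"
    by (rule poly_ext) (simp add: poly_shift algebra_simps)
  have "L (shift 1 ([:0, 1:] * p n) * p n)
      = a (Suc n) * L (shift 1 (p (Suc n)) * p n) + b n + L (shift 1 (prev n) * p n)"
    unfolding rec by (simp add: pcompose_add pcompose_smult distrib_right L_add L_smult orth_shift)
  moreover have "L (shift 1 (p n) * ([:0, 1:] * p n)) = b n + L (shift 1 (p n) * prev n)"
    unfolding rec
    by (simp add: distrib_left L_add L_smult orth_shift orth_low degree_p)
  ultimately have "a (Suc n) * L (shift 1 (p (Suc n)) * p n) = real n + 1"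
    unfolding 1 using Suc by (simp only: L_add orth_shift orth_shift_prev')
  then show ?case by (simp add: L_smult)
qed simp

section \<open>The Christoffel-Darboux kernel\<close>

definition kern :: "nat \<Rightarrow> real \<Rightarrow> real poly" where
  "kern n x = (\<Sum>j<n. smult (poly (p j) x) (p j))"

text \<open>The factor \<open>x - y\<close> replaces a quotient; the induction step is the
  recurrence at \<open>x\<close> and at \<open>y\<close>.\<close>

lemma christoffel_darboux:
  "kern n x * [:x, -1:] = smult (poly (p n) x) (prev n) - smult (poly (prev n) x) (p n)"
proof (rule poly_ext)
  fix y
  show "poly (kern n x * [:x, -1:]) y
      = poly (smult (poly (p n) x) (prev n) - smult (poly (prev n) x) (p n)) y"
  proof (induction n)
    case 0
    show ?case by (simp add: kern_def)
  next
    case (Suc n)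
    have "poly (kern (Suc n) x * [:x, -1:]) y
        = poly (kern n x * [:x, -1:]) y + (x * poly (p n) x) * poly (p n) y
          - poly (p n) x * (y * poly (p n) y)"
      by (simp add: kern_def algebra_simps)
    then show ?case
      unfolding Suc rec_poly by (simp add: algebra_simps)
  qed
qed

lemma reproducing:
  assumes "degree q < n"
  shows "L (q * kern n x) = poly q x"
proof -
  obtain d where q: "q = (\<Sum>j<n. smult (d j) (p j))" using span[OF assms] by blast
  have "L (q * p j) = d j" if "j < n" for j
    using that by (simp add: q sum_distrib_right L_sum L_smult orth if_distrib cong: if_cong)
  then show ?thesis
    by (simp add: kern_def sum_distrib_left L_sum L_smult)
      (simp add: q poly_sum mult.commute)
qed

text \<open>With the summand \<open>j = n\<close> added, the kernel reproduces
  \<open>shift h (p n)\<close>; by \<open>orth_shift\<close> that summand contributes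
  \<open>poly (p n) x\<close>.\<close>

lemma shift_kern: "L (shift h (p n) * kern n x) = poly (p n) (x + h) - poly (p n) x"
proof -
  have "L (shift h (p n) * kern (Suc n) x) = poly (p n) (x + h)"
    by (simp add: reproducing degree_p poly_shift)
  then show ?thesis
    by (simp add: kern_def distrib_left L_add L_smult orth_shift)
qed

lemma orth_shift_kern: "L (p n * shift h (kern n x)) = 0"
  by (simp add: kern_def pcompose_sum pcompose_smult sum_distrib_left L_sum L_smult
      orth_low degree_p)

section \<open>The functional \<open>phi\<close> and the ladder coefficients\<close>

text \<open>For \<open>L f = (\<Sum>k. f(k) w\<^sub>k)\<close> this is \<open>(x + \<alpha>)(x + \<beta>) (\<Sum>k. f(k) (u(x + 1) - u(k)) / (x + 1 - k) w\<^sub>k)\<close>, with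
  the terms \<open>(u(k) + 1) w\<^sub>k = w\<^sub>k\<^sub>-\<^sub>1\<close> summed by an index shift.\<close>

definition phi :: "real \<Rightarrow> real poly \<Rightarrow> real" where
  "phi x f = L ([:x + \<gamma>, 1:] * f) / c - L ([:x + \<alpha> + \<beta>, 1:] * shift 1 f)"

lemma phi_0 [simp]: "phi x 0 = 0"
  by (simp add: phi_def)

lemma phi_add: "phi x (f + g) = phi x f + phi x g"
  by (simp add: phi_def distrib_left L_add pcompose_add add_divide_distrib)

lemma phi_smult: "phi x (smult r f) = r * phi x f"
  by (simp add: phi_def L_smult pcompose_smult right_diff_distrib)

lemma phi_diff: "phi x (f - g) = phi x f - phi x g"
  using phi_add[of x f "smult (-1) g"] phi_smult[of x "-1" g] by simp

text \<open>The variable \<open>x\<close> enters \<open>phi\<close> only through the constant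
  coefficients of two linear factors.\<close>

lemma phi_affine: "phi x f = x * (L f / c - L (shift 1 f)) + phi 0 f"
proof -
  have "[:x + r, 1:] * q = smult x q + [:r, 1:] * q" for r and q :: "real poly"
    by (rule poly_ext) (simp add: algebra_simps)
  then show ?thesis
    by (simp add: phi_def L_add L_smult add.assoc algebra_simps add_divide_distrib)
qed

text \<open>The Pearson equation makes the terms that do not depend on \<open>x\<close> cancel.\<close>

lemma phi_mult:
  "phi x (f * [:x + 1, -1:])
    = (x + 1) * (x + \<gamma>) / c * L f - (x + \<alpha>) * (x + \<beta>) * L (shift 1 f)"
proof -
  have 1: "[:x + \<gamma>, 1:] * (f * [:x + 1, -1:])
      = smult ((x + 1) * (x + \<gamma>)) f - [:0, \<gamma> - 1, 1:] * f"
    by (rule poly_ext) (simp add: algebra_simps)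
  have 2: "[:x + \<alpha> + \<beta>, 1:] * shift 1 (f * [:x + 1, -1:])
      = smult ((x + \<alpha>) * (x + \<beta>)) (shift 1 f) - [:\<alpha>, 1:] * [:\<beta>, 1:] * shift 1 f"
    by (rule poly_ext) (simp add: poly_shift algebra_simps)
  show ?thesis
    unfolding phi_def 1 2 using c
    by (simp add: L_diff L_smult pearson diff_divide_distrib del: mult_pCons_left)
qed

text \<open>\<open>A n\<close> and \<open>B n\<close> are \<open>A\<^sub>n/a\<^sub>n\<close> and \<open>B\<^sub>n\<close> of the paper, multiplied by \<open>(x + \<alpha>)(x + \<beta>)\<close>.\<close>

definition A :: "nat \<Rightarrow> real \<Rightarrow> real" where
  "A n x = phi x (p n * shift (-1) (p n))"
definition B :: "nat \<Rightarrow> real \<Rightarrow> real" where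
  "B n x = phi x (p n * shift (-1) (prev n))"
text \<open>Counterpart of \<open>B n\<close> with the back shift on the other factor; it governs
  the step from \<open>x + 1\<close> to \<open>x\<close>.\<close>

definition B' :: "nat \<Rightarrow> real \<Rightarrow> real" where
  "B' n x = phi x (shift (-1) (p n) * prev n)"
text \<open>\<open>X n\<close> and \<open>Y n\<close> are the unknowns \<open>x_n\<close> and
  \<open>y_n\<close>, read off at \<open>x = 0\<close>.\<close>

definition X :: "nat \<Rightarrow> real" where
  "X n = c / (1 - c) * A n 0"
definition Y :: "nat \<Rightarrow> real" where
  "Y n = B n 0"

lemma A_eq: "A n x = (1 - c) / c * (x + X n)"
proof -
  have "shift 1 (p n * shift (-1) (p n)) = shift 1 (p n) * p n"
    by (simp add: pcompose_mult shift_shift shift_zero)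
  then have "A n x = x * (1 / c - 1) + A n 0"
    using phi_affine[of x "p n * shift (-1) (p n)"] orth_shift'[where h = "-1" and n = n]
    by (simp add: A_def orth_shift)
  also have "1 / c - 1 = (1 - c) / c"
    using c by (simp add: diff_divide_distrib)
  also have "A n 0 = (1 - c) / c * X n"
    using c by (simp add: X_def)
  finally show ?thesis
    by (simp only: distrib_left mult.commute)
qed

lemma B_eq: "B n x = - real n * x + Y n"
proof -
  have "shift 1 (p n * shift (-1) (prev n)) = shift 1 (p n) * prev n"
    by (simp add: pcompose_mult shift_shift shift_zero)
  then show ?thesis
    using phi_affine[of x "p n * shift (-1) (prev n)"]
    by (simp add: B_def Y_def orth_shift_prev shift_prev)
qed

section \<open>Ladder relations in both directions\<close>

text \<open>\<open>phi x\<close> of \<open>p n\<close> times the back-shifted kernel times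
  \<open>x + 1 - y\<close> is computed twice. Christoffel-Darboux gives \<open>A n x\<close> and
  \<open>B n x\<close>; in \<open>phi_mult\<close> the first term vanishes by orthogonality and the
  second yields the difference on the left.\<close>

lemma lowering:
  "(x + \<alpha>) * (x + \<beta>) * (poly (p n) (x + 1) - poly (p n) x)
    = A n x * poly (prev n) x - B n x * poly (p n) x"
proof -
  let ?g = "shift (-1) (kern n x)"
  have "?g * [:x + 1, -1:] = shift (-1) (kern n x * [:x, -1:])"
    by (rule poly_ext) (simp add: poly_shift algebra_simps)
  also have "\<dots> = smult (poly (p n) x) (shift (-1) (prev n))
      - smult (poly (prev n) x) (shift (-1) (p n))"
    by (simp only: christoffel_darboux pcompose_diff pcompose_smult)
  finally have "phi x (p n * ?g * [:x + 1, -1:]) = poly (p n) x * B n x - poly (prev n) x * A n x"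
    unfolding mult.assoc by (simp add: right_diff_distrib phi_diff phi_smult A_def B_def)
  moreover have "shift 1 (p n * ?g) = shift 1 (p n) * kern n x"
    by (simp add: pcompose_mult shift_shift shift_zero)
  ultimately have "(x + \<alpha>) * (x + \<beta>) * (poly (p n) (x + 1) - poly (p n) x)
      = poly (prev n) x * A n x - poly (p n) x * B n x"
    unfolding phi_mult by (simp add: orth_shift_kern shift_kern)
  then show ?thesis by (simp add: mult.commute)
qed

text \<open>As for \<open>lowering\<close>, with the back shift on \<open>p n\<close> and the kernel
  taken at \<open>x + 1\<close>; now the second term of \<open>phi_mult\<close> vanishes.\<close>

lemma backward:
  "(x + 1) * (x + \<gamma>) / c * poly (p n) x
    = ((x + 1) * (x + \<gamma>) / c + B' n x) * poly (p n) (x + 1) - A n x * poly (prev n) (x + 1)"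
proof -
  let ?g = "kern n (x + 1)"
  have "shift (-1) (p n) * ?g * [:x + 1, -1:]
      = smult (poly (p n) (x + 1)) (shift (-1) (p n) * prev n)
        - smult (poly (prev n) (x + 1)) (p n * shift (-1) (p n))"
    unfolding mult.assoc christoffel_darboux by (simp add: right_diff_distrib mult.commute)
  then have "phi x (shift (-1) (p n) * ?g * [:x + 1, -1:])
      = poly (p n) (x + 1) * B' n x - poly (prev n) (x + 1) * A n x"
    by (simp add: phi_diff phi_smult A_def B'_def)
  moreover have "shift 1 (shift (-1) (p n) * ?g) = p n * shift 1 ?g"
    by (simp add: pcompose_mult shift_shift shift_zero)
  ultimately have "(x + 1) * (x + \<gamma>) / c * (poly (p n) x - poly (p n) (x + 1))
      = poly (p n) (x + 1) * B' n x - poly (prev n) (x + 1) * A n x"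
    unfolding phi_mult by (simp add: orth_shift_kern shift_kern)
  then show ?thesis
    unfolding right_diff_distrib distrib_right by (simp only: mult.commute)
qed

section \<open>The determinant identity\<close>

text \<open>The recurrence at \<open>y - 1\<close> merges both arguments of \<open>phi\<close> into
  \<open>y - 1 - b n\<close> times that of \<open>A n\<close>. Writing
  \<open>y - 1 = x - (x + 1 - y)\<close> lets \<open>phi_mult\<close> evaluate the rest.\<close>

lemma B_add_B':
  "B n x + B' (Suc n) x
    = (x - b n) * A n x - (x + 1) * (x + \<gamma>) / c + (x + \<alpha>) * (x + \<beta>)"
proof -
  let ?f = "p n * shift (-1) (p n)"
  have "p n * shift (-1) (prev n) + shift (-1) (p (Suc n)) * prev (Suc n)
      = smult (x - b n) ?f - ?f * [:x + 1, -1:]"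
  proof (rule poly_ext)
    fix y
    show "poly (p n * shift (-1) (prev n) + shift (-1) (p (Suc n)) * prev (Suc n)) y
      = poly (smult (x - b n) ?f - ?f * [:x + 1, -1:]) y"
      using arg_cong[OF rec_poly[of "y - 1" n], of "\<lambda>t. poly (p n) y * t"]
      by (simp add: poly_shift algebra_simps)
  qed
  then have "B n x + B' (Suc n) x = (x - b n) * A n x - phi x (?f * [:x + 1, -1:])"
    unfolding B_def B'_def A_def phi_add[symmetric] by (simp only: phi_diff phi_smult)
  moreover have "shift 1 ?f = shift 1 (p n) * p n"
    by (simp add: pcompose_mult shift_shift shift_zero)
  ultimately show ?thesis
    unfolding phi_mult by (simp add: orth_shift orth_shift')
qed

lemma determinant_weak:
  assumes "poly (p (Suc n)) x \<noteq> 0"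
  shows "((x + \<alpha>) * (x + \<beta>) - B (Suc n) x) * ((x + \<alpha>) * (x + \<beta>) - B n x + (x - b n) * A n x)
    + (a (Suc n))\<^sup>2 * A (Suc n) x * A n x
    = (x + 1) * (x + \<gamma>) / c * ((x + \<alpha>) * (x + \<beta>))"
proof -
  define N D where "N = (x + 1) * (x + \<gamma>) / c" and "D = (x + \<alpha>) * (x + \<beta>)"
  define M where "M = D - B n x + (x - b n) * A n x"
  let ?p = "poly (p (Suc n))" and ?q = "poly (p n)" and ?a = "a (Suc n)"
  \<comment> \<open>The same entry \<open>M\<close> occurs in the forward and in the backward
    matrix, as in an adjugate.\<close>
  have M: "N + B' (Suc n) x = M"
    using B_add_B'[of n x] by (simp add: M_def N_def D_def)
  have inverse: "N * ?p x = M * ?p (x + 1) - A (Suc n) x * (?a * ?q (x + 1))"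
    using backward[of x "Suc n"] unfolding M[symmetric] N_def by simp
  have low: "D * ?p (x + 1) = A (Suc n) x * (?a * ?q x) + (D - B (Suc n) x) * ?p x"
    using lowering[of x "Suc n"] unfolding D_def[symmetric] prev_simps poly_smult by algebra
  have "D * ?q (x + 1) = A n x * poly (prev n) x + (D - B n x) * ?q x"
    using lowering[of x n] unfolding D_def[symmetric] by algebra
  then have low': "D * ?q (x + 1) = M * ?q x - ?a * A n x * ?p x"
    using rec_poly[of x n] unfolding M_def by algebra
  have "((D - B (Suc n) x) * M + ?a\<^sup>2 * A (Suc n) x * A n x) * ?p x = N * D * ?p x"
    using inverse low low' by algebra
  then show ?thesis
    using assms unfolding M_def N_def[symmetric] D_def[symmetric] by simp
qed

text \<open>The difference of the two sides is a polynomial whose product with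
  \<open>p (Suc n)\<close> vanishes everywhere, so it is zero also at the zeros of
  \<open>p (Suc n)\<close>.\<close>

lemma determinant:
  "((x + \<alpha>) * (x + \<beta>) - B (Suc n) x) * ((x + \<alpha>) * (x + \<beta>) - B n x + (x - b n) * A n x)
    + (a (Suc n))\<^sup>2 * A (Suc n) x * A n x
    = (x + 1) * (x + \<gamma>) / c * ((x + \<alpha>) * (x + \<beta>))"
proof -
  let ?A = "\<lambda>n. smult ((1 - c) / c) [:X n, 1:]" and ?B = "\<lambda>n. [:Y n, - real n:]"
  let ?D = "[:\<alpha>, 1:] * [:\<beta>, 1:]"
  define q where "q = (?D - ?B (Suc n)) * (?D - ?B n + [:- b n, 1:] * ?A n)
    + smult ((a (Suc n))\<^sup>2) (?A (Suc n) * ?A n) - smult (1 / c) ([:1, 1:] * [:\<gamma>, 1:]) * ?D"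
  have A: "A n x = poly (?A n) x" and B: "B n x = poly (?B n) x" for n x
    unfolding A_eq B_eq by (simp_all add: algebra_simps)
  have q: "poly q x = ((x + \<alpha>) * (x + \<beta>) - B (Suc n) x)
        * ((x + \<alpha>) * (x + \<beta>) - B n x + (x - b n) * A n x)
      + (a (Suc n))\<^sup>2 * A (Suc n) x * A n x
      - (x + 1) * (x + \<gamma>) / c * ((x + \<alpha>) * (x + \<beta>))" for x
    unfolding A B q_def by (simp add: add.commute mult.assoc del: mult_pCons_left mult_pCons_right)
  have "q * p (Suc n) = 0"
    by (rule poly_ext) (use determinant_weak q in auto)
  moreover have "p (Suc n) \<noteq> 0" using lead_p[of "Suc n"] by auto
  ultimately have "q = 0" by simp
  then show ?thesis using q[of x] by simp
qed

lemma first_equation: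
  "(Y n - \<alpha> * \<beta> + (\<alpha> + \<beta> + real n) * X n - (X n)\<^sup>2)
    * (Y (n + 1) - \<alpha> * \<beta> + (\<alpha> + \<beta> + real n + 1) * X n - (X n)\<^sup>2)
    = 1 / c * (X n - 1) * (X n - \<alpha>) * (X n - \<beta>) * (X n - \<gamma>)"
proof -
  have "((\<alpha> - X n) * (\<beta> - X n) - (Y (Suc n) - (- 1 - real n) * X n))
      * ((\<alpha> - X n) * (\<beta> - X n) - (real n * X n + Y n))
      = 1 / c * (1 - X n) * (\<gamma> - X n) * ((\<alpha> - X n) * (\<beta> - X n))"
    using determinant[of "- X n" n] unfolding A_eq B_eq by simp
  then show ?thesis
    unfolding Suc_eq_plus1 by algebra
qed

end

section \<open>Elimination for the second recurrence\<close>

lemma cubic_coeffs_zero: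
  fixes q0 q1 q2 q3 :: real
  assumes "\<And>x. q3 * x ^ 3 + q2 * x\<^sup>2 + q1 * x + q0 = 0"
  shows "q0 = 0" "q1 = 0" "q2 = 0" "q3 = 0"
  using assms[of 0] assms[of 1] assms[of "-1"] assms[of 2] by simp_all

text \<open>Comparing coefficients in the determinant identity gives three equations that are linear in
  \<open>t\<close>, in the constant term of the second factor, and in 1. Their determinant vanishes, which
  is the claim after multiplication with \<open>Y_den\<close>.\<close>

lemma eliminate:
  fixes \<alpha> \<beta> \<gamma> c y m1 m0 t u v :: real
  assumes "c \<noteq> 0"
    and "\<And>x. ((x + \<alpha>) * (x + \<beta>) + real n * x - y) * (x\<^sup>2 / c + m1 * x + m0) + t * (x + u) * (x + v)
      = (x + 1) * (x + \<gamma>) / c * ((x + \<alpha>) * (x + \<beta>))"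
  shows "(Y_den \<alpha> \<beta> \<gamma> n y * u + Y_num \<alpha> \<beta> \<gamma> n y) * (Y_den \<alpha> \<beta> \<gamma> n y * v + Y_num \<alpha> \<beta> \<gamma> n y)
    = (y + real n * \<alpha>) * (y + real n * \<beta>) * (y + real n * \<gamma> - (\<gamma> - \<alpha>) * (\<gamma> - \<beta>))
      * (y + real n - (1 - \<alpha>) * (1 - \<beta>))"
proof -
  \<comment> \<open>The first factor is \<open>x\<^sup>2 + P * x + Q\<close>; scaling by
    \<open>c\<close> clears the denominators.\<close>
  define P Q where "P = \<alpha> + \<beta> + real n" and "Q = \<alpha> * \<beta> - y"
  define M1 M0 T where "M1 = c * m1" and "M0 = c * m0" and "T = c * t"
  have "(M1 + P - (1 + \<gamma> + \<alpha> + \<beta>)) * x ^ 3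
      + (M0 + P * M1 + Q + T - (\<gamma> + (1 + \<gamma>) * (\<alpha> + \<beta>) + \<alpha> * \<beta>)) * x\<^sup>2
      + (P * M0 + Q * M1 + T * (u + v) - (\<gamma> * (\<alpha> + \<beta>) + (1 + \<gamma>) * (\<alpha> * \<beta>))) * x
      + (Q * M0 + T * (u * v) - \<gamma> * \<alpha> * \<beta>) = 0" for x
  proof -
    have "((x + \<alpha>) * (x + \<beta>) + real n * x - y) * (x\<^sup>2 + M1 * x + M0) + T * (x + u) * (x + v)
      = c * (((x + \<alpha>) * (x + \<beta>) + real n * x - y) * (x\<^sup>2 / c + m1 * x + m0) + t * (x + u) * (x + v))"
      using assms(1) by (simp add: M1_def M0_def T_def field_simps)
    also have "\<dots> = (x + 1) * (x + \<gamma>) * ((x + \<alpha>) * (x + \<beta>))"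
      unfolding assms(2) using assms(1) by simp
    finally show ?thesis
      unfolding P_def Q_def by algebra
  qed
  from cubic_coeffs_zero[OF this]
  have M1: "M1 = \<gamma> + 1 - real n"
    and r1: "M0 + P * M1 + Q + T - (\<gamma> + (1 + \<gamma>) * (\<alpha> + \<beta>) + \<alpha> * \<beta>) = 0" (is "?r1 = 0")
    and r2: "P * M0 + Q * M1 + T * (u + v) - (\<gamma> * (\<alpha> + \<beta>) + (1 + \<gamma>) * (\<alpha> * \<beta>)) = 0" (is "?r2 = 0")
    and r3: "Q * M0 + T * (u * v) - \<gamma> * \<alpha> * \<beta> = 0" (is "?r3 = 0")
    by (simp_all add: P_def)
  \<comment> \<open>The multipliers of the three residuals are, up to sign, the 2x2 minors of the
    columns \<open>(1, P, Q)\<close> and \<open>(1, u + v, u * v)\<close>, so \<open>M0\<close> and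
    \<open>T\<close> drop out.\<close>
  have "(Y_den \<alpha> \<beta> \<gamma> n y * u + Y_num \<alpha> \<beta> \<gamma> n y) * (Y_den \<alpha> \<beta> \<gamma> n y * v + Y_num \<alpha> \<beta> \<gamma> n y)
      - (y + real n * \<alpha>) * (y + real n * \<beta>) * (y + real n * \<gamma> - (\<gamma> - \<alpha>) * (\<gamma> - \<beta>))
        * (y + real n - (1 - \<alpha>) * (1 - \<beta>))
    = Y_den \<alpha> \<beta> \<gamma> n y * (((u + v) * Q - P * (u * v)) * ?r1 - (Q - u * v) * ?r2 + (P - (u + v)) * ?r3)"
    unfolding M1 P_def Q_def Y_den_def Y_num_def by algebra
  then show ?thesis by (simp add: r1 r2 r3)
qed

context pearson_functional
begin

lemma second_equation:
  fixes n :: nat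
  defines "D \<equiv> Y_den \<alpha> \<beta> \<gamma> (Suc n) (Y (Suc n))" and "N \<equiv> Y_num \<alpha> \<beta> \<gamma> (Suc n) (Y (Suc n))"
  shows "(D * X (Suc n) + N) * (D * X n + N)
    = (Y (Suc n) + real (Suc n) * \<alpha>) * (Y (Suc n) + real (Suc n) * \<beta>)
      * (Y (Suc n) + real (Suc n) * \<gamma> - (\<gamma> - \<alpha>) * (\<gamma> - \<beta>))
      * (Y (Suc n) + real (Suc n) - (1 - \<alpha>) * (1 - \<beta>))"
  unfolding D_def N_def
proof (rule eliminate[OF c(1)])
  fix x
  define K where "K = (1 - c) / c"
  \<comment> \<open>The coefficient \<open>1 / c\<close> is 1 from
    \<open>(x + \<alpha>) * (x + \<beta>)\<close> plus \<open>K\<close> from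
    \<open>(x - b n) * A n x\<close>.\<close>
  have K: "x\<^sup>2 / c = x\<^sup>2 + K * x\<^sup>2"
    using c by (simp add: K_def field_simps)
  show "((x + \<alpha>) * (x + \<beta>) + real (Suc n) * x - Y (Suc n))
      * (x\<^sup>2 / c + (\<alpha> + \<beta> + real n + K * (X n - b n)) * x + (\<alpha> * \<beta> - Y n - K * X n * b n))
      + ((a (Suc n))\<^sup>2 * K\<^sup>2) * (x + X (Suc n)) * (x + X n)
      = (x + 1) * (x + \<gamma>) / c * ((x + \<alpha>) * (x + \<beta>))"
    unfolding determinant[of x n, symmetric] A_eq B_eq K_def[symmetric] K by algebra
qed

end

section \<open>Moments of the hypergeometric weights\<close>

text \<open>Convergence comes from orthonormality: \<open>p 0\<close> is a positive constant, so the
  series of \<open>p j\<close> against \<open>p 0\<close> settles each \<open>p j\<close>, and these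
  span all polynomials.\<close>

lemma orthonormal_summable:
  assumes "orthonormal_polys w p"
  shows "summable (\<lambda>k. poly f (real k) * w k)"
proof -
  have deg: "degree (p n) = n" and lead: "lead_coeff (p n) > 0" for n
    using assms unfolding orthonormal_polys_def by blast+
  obtain d where f: "f = (\<Sum>j<Suc (degree f). smult (d j) (p j))"
    using poly_span_degree[of p f "Suc (degree f)"] deg lead by (metis lessI less_irrefl)
  obtain r where r: "p 0 = [:r:]"
    using deg[of 0] degree_0_id by metis
  with lead[of 0] have "r > 0" by simp
  have "summable (\<lambda>k. poly (p j) (real k) * w k)" for j
  proof -
    have "summable (\<lambda>k. poly (p j) (real k) * poly (p 0) (real k) * w k)"
      using assms unfolding orthonormal_polys_def by (blast intro: sums_summable)
    from summable_mult[OF this, of "1 / r"] show ?thesis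
      using \<open>r > 0\<close> by (simp add: r)
  qed
  then have "summable (\<lambda>k. \<Sum>j<Suc (degree f). d j * (poly (p j) (real k) * w k))"
    by (intro summable_sum summable_mult)
  also have "(\<lambda>k. \<Sum>j<Suc (degree f). d j * (poly (p j) (real k) * w k))
      = (\<lambda>k. poly f (real k) * w k)"
    by (subst (2) f) (simp add: poly_sum sum_distrib_right mult.assoc del: sum.lessThan_Suc)
  finally show ?thesis .
qed

definition moment :: "(nat \<Rightarrow> real) \<Rightarrow> real poly \<Rightarrow> real" where
  "moment w f = (\<Sum>k. poly f (real k) * w k)"

lemma hg_weight_Suc:
  assumes "\<gamma> > 0"
  shows "(\<gamma> + real k) * (real k + 1) * hg_weight \<alpha> \<beta> \<gamma> c (Suc k)
    = c * (\<alpha> + real k) * (\<beta> + real k) * hg_weight \<alpha> \<beta> \<gamma> c k"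
proof -
  have "pochhammer \<gamma> k \<noteq> 0" "\<gamma> + real k \<noteq> 0"
    using assms pochhammer_pos[of \<gamma> k] by auto
  then show ?thesis
    by (simp add: hg_weight_def pochhammer_rec' divide_simps)
qed

text \<open>One such point determines the constants in \<open>hg_x\<close> and \<open>hg_y\<close>.
  The witness lies left of both poles and makes \<open>x + 1\<close> negative.\<close>

lemma regular_point_exists:
  assumes "\<alpha> > 0" "\<beta> > 0"
  shows "- (\<alpha> + \<beta> + 1) \<in> regular_points \<alpha> \<beta>"
  unfolding regular_points_def using assms by (auto simp: algebra_simps)

context
  fixes \<alpha> \<beta> \<gamma> c :: real and w u
  defines "w \<equiv> hg_weight \<alpha> \<beta> \<gamma> c" and "u \<equiv> hg_potential \<alpha> \<beta> \<gamma> c"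
  assumes pos: "\<alpha> > 0" "\<beta> > 0" "\<gamma> > 0" "0 < c"
    and summable: "\<And>f. summable (\<lambda>k. poly f (real k) * w k)"
begin

lemma moment_sums: "(\<lambda>k. poly f (real k) * w k) sums moment w f"
  unfolding moment_def by (rule summable_sums[OF summable])

text \<open>The value 0 at \<open>k = 0\<close> stands for \<open>w (-1)\<close>; truncated
  subtraction alone would give \<open>w 0\<close> there.\<close>

lemma moment_shift_sums:
  "(\<lambda>k. poly f (real k) * (if k = 0 then 0 else w (k - 1))) sums moment w (shift 1 f)"
  using moment_sums[of "shift 1 f"] sums_Suc_imp[where f = "\<lambda>k. poly f (real k) * (if k = 0 then 0 else w (k - 1))"]
  by (simp add: poly_shift add.commute)

lemma weight_pearson:
  "real k * (real k + \<gamma> - 1) * w k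
    = c * (real k + \<alpha> - 1) * (real k + \<beta> - 1) * (if k = 0 then 0 else w (k - 1))"
proof (cases k)
  case (Suc m)
  then show ?thesis
    using hg_weight_Suc[OF pos(3), of m \<alpha> \<beta> c] by (simp add: w_def algebra_simps)
qed simp

lemma moment_pearson:
  "moment w ([:0, \<gamma> - 1, 1:] * f) = c * moment w ([:\<alpha>, 1:] * [:\<beta>, 1:] * shift 1 f)"
proof -
  let ?g = "[:\<alpha> - 1, 1:] * [:\<beta> - 1, 1:] * f"
  have g: "shift 1 ?g = [:\<alpha>, 1:] * [:\<beta>, 1:] * shift 1 f"
    by (rule poly_ext) (simp add: poly_shift algebra_simps)
  have "c * (poly ?g (real k) * (if k = 0 then 0 else w (k - 1)))
      = poly ([:0, \<gamma> - 1, 1:] * f) (real k) * w k" for k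
  proof -
    define v where "v = (if k = 0 then 0 else w (k - 1))"
    have "c * (poly ?g (real k) * v)
        = poly f (real k) * (c * (real k + \<alpha> - 1) * (real k + \<beta> - 1) * v)"
      by (simp add: algebra_simps)
    also have "\<dots> = poly ([:0, \<gamma> - 1, 1:] * f) (real k) * w k"
      unfolding weight_pearson[of k, folded v_def, symmetric] by (simp add: algebra_simps)
    finally show ?thesis unfolding v_def .
  qed
  then have "(\<lambda>k. poly ([:0, \<gamma> - 1, 1:] * f) (real k) * w k) sums (c * moment w (shift 1 ?g))"
    using sums_mult[OF moment_shift_sums[of ?g], of c] by (simp only:)
  from sums_unique2[OF moment_sums this] show ?thesis
    unfolding g .
qed

text \<open>The Pearson equation in terms of \<open>u\<close>. At \<open>k = 0\<close> both sides
  are 0 because \<open>u 0 = -1\<close>.\<close>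

lemma potential_weight: "(u (real k) + 1) * w k = (if k = 0 then 0 else w (k - 1))"
proof (cases k)
  case (Suc m)
  have "\<alpha> + real m > 0" "\<beta> + real m > 0"
    using pos by auto
  then have nz: "c * (\<alpha> + real m) * (\<beta> + real m) \<noteq> 0"
    using pos(4) by auto
  have "(u (real k) + 1) * w k
      = ((\<gamma> + real m) * (real m + 1) * w (Suc m)) / (c * (\<alpha> + real m) * (\<beta> + real m))"
    unfolding Suc u_def hg_potential_def by (simp add: add.commute add.left_commute)
  also have "\<dots> = w m"
    unfolding w_def hg_weight_Suc[OF pos(3)] using nz by (rule nonzero_mult_div_cancel_left)
  finally show ?thesis by (simp add: Suc)
qed (simp add: u_def hg_potential_def)

lemma difference_quotient_weight:
  assumes "x \<in> regular_points \<alpha> \<beta>"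
  shows "(u (x + 1) - u (real k)) / (x + 1 - real k) * w k
    = ((x + \<gamma> + real k) / c * w k
        - (x + \<alpha> + \<beta> - 1 + real k) * (if k = 0 then 0 else w (k - 1))) / ((x + \<alpha>) * (x + \<beta>))"
proof -
  define v D t where "v = (if k = 0 then 0 else w (k - 1))" and "D = (x + \<alpha>) * (x + \<beta>)"
    and "t = x + 1 - real k"
  have nz: "D \<noteq> 0" "t \<noteq> 0" "c \<noteq> 0"
    using assms pos by (auto simp: D_def t_def regular_points_def add_eq_0_iff2)
  have "(u (x + 1) - u (real k)) * w k = (u (x + 1) + 1) * w k - v"
    using potential_weight[of k] by (simp add: v_def algebra_simps)
  also have "u (x + 1) + 1 = (x + \<gamma>) * (x + 1) / (c * D)"
    by (simp add: u_def hg_potential_def D_def algebra_simps)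
  also have "\<dots> * w k - v = ((x + \<gamma>) * (x + 1) * w k - c * D * v) / (c * D)"
    using nz by (simp add: diff_divide_distrib)
  \<comment> \<open>By the Pearson equation the numerator is divisible by \<open>t\<close>, which
    removes the difference quotient.\<close>
  also have "(x + \<gamma>) * (x + 1) * w k - c * D * v
      = t * ((x + \<gamma> + real k) * w k - c * (x + \<alpha> + \<beta> - 1 + real k) * v)"
    using weight_pearson[of k] unfolding v_def[symmetric] D_def t_def by algebra
  finally have "(u (x + 1) - u (real k)) / t * w k
      = ((x + \<gamma> + real k) * w k - c * (x + \<alpha> + \<beta> - 1 + real k) * v) / (c * D)"
    using nz by simp
  also have "\<dots> = ((x + \<gamma> + real k) / c * w k - (x + \<alpha> + \<beta> - 1 + real k) * v) / D"
    using nz by (simp add: diff_divide_distrib)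
  finally show ?thesis unfolding v_def D_def t_def .
qed

lemma difference_quotient_sums:
  assumes "x \<in> regular_points \<alpha> \<beta>"
  shows "(\<lambda>k. poly f (real k) * ((u (x + 1) - u (real k)) / (x + 1 - real k)) * w k) sums
    ((moment w ([:x + \<gamma>, 1:] * f) / c - moment w ([:x + \<alpha> + \<beta>, 1:] * shift 1 f))
      / ((x + \<alpha>) * (x + \<beta>)))"
proof -
  let ?g = "[:x + \<alpha> + \<beta> - 1, 1:] * f"
  have g: "shift 1 ?g = [:x + \<alpha> + \<beta>, 1:] * shift 1 f"
    by (rule poly_ext) (simp add: poly_shift algebra_simps)
  from sums_divide[OF sums_diff[OF sums_divide[OF moment_sums[of "[:x + \<gamma>, 1:] * f"]]
      moment_shift_sums[of ?g]]]
  have "(\<lambda>k. (poly ([:x + \<gamma>, 1:] * f) (real k) * w k / c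
        - poly ?g (real k) * (if k = 0 then 0 else w (k - 1))) / ((x + \<alpha>) * (x + \<beta>))) sums
    ((moment w ([:x + \<gamma>, 1:] * f) / c - moment w ([:x + \<alpha> + \<beta>, 1:] * shift 1 f))
      / ((x + \<alpha>) * (x + \<beta>)))"
    unfolding g .
  also have "(\<lambda>k. (poly ([:x + \<gamma>, 1:] * f) (real k) * w k / c
        - poly ?g (real k) * (if k = 0 then 0 else w (k - 1))) / ((x + \<alpha>) * (x + \<beta>)))
    = (\<lambda>k. poly f (real k) * ((u (x + 1) - u (real k)) / (x + 1 - real k)) * w k)"
    unfolding mult.assoc difference_quotient_weight[OF assms]
    by (rule ext) (simp add: algebra_simps diff_divide_distrib add_divide_distrib)
  finally show ?thesis .
qed

end

section \<open>Identification of the sequences and the initial values\<close>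

theorem theorem3p1:
  fixes \<alpha> \<beta> \<gamma> c :: real
    and p :: "nat \<Rightarrow> real poly"
    and a b x y Y :: "nat \<Rightarrow> real"
  assumes "\<alpha> > 0" "\<beta> > 0" "\<gamma> > 0" "0 < c" "c < 1"
    and "orthonormal_polys (hg_weight \<alpha> \<beta> \<gamma> c) p"
    and "three_term_recurrence p a b"
  defines "x \<equiv> hg_x \<alpha> \<beta> \<gamma> c p"
    and "y \<equiv> hg_y \<alpha> \<beta> \<gamma> c p a"
    and "Y \<equiv> \<lambda>n. Y_num \<alpha> \<beta> \<gamma> n (y n) / Y_den \<alpha> \<beta> \<gamma> n (y n)"
  shows "(\<forall>n. (y n - \<alpha> * \<beta> + (\<alpha> + \<beta> + real n) * x n - (x n)\<^sup>2)
            * (y (n + 1) - \<alpha> * \<beta> + (\<alpha> + \<beta> + real n + 1) * x n - (x n)\<^sup>2)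
            = 1 / c * (x n - 1) * (x n - \<alpha>) * (x n - \<beta>) * (x n - \<gamma>))
    \<and> (\<forall>n\<ge>1. Y_den \<alpha> \<beta> \<gamma> n (y n) \<noteq> 0 \<longrightarrow>
          (x n + Y n) * (x (n - 1) + Y n)
            = (y n + real n * \<alpha>) * (y n + real n * \<beta>)
              * (y n + real n * \<gamma> - (\<gamma> - \<alpha>) * (\<gamma> - \<beta>))
              * (y n + real n - (1 - \<alpha>) * (1 - \<beta>))
              / (Y_den \<alpha> \<beta> \<gamma> n (y n))\<^sup>2)
    \<and> y 0 = 0
    \<and> x 0 = c * \<alpha> * \<beta> / \<gamma>
              * (hyp2F1 (\<alpha> + 1) (\<beta> + 1) (\<gamma> + 1) c / hyp2F1 \<alpha> \<beta> \<gamma> c)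
            - ((\<alpha> + \<beta>) * c - \<gamma>) / (1 - c)"
proof -
  define w where "w = hg_weight \<alpha> \<beta> \<gamma> c"
  note pos = assms(1-4)
  have orth: "orthonormal_polys w p"
    using assms(6) by (simp add: w_def)
  note summable = orthonormal_summable[OF orth]
  interpret P: pearson_functional \<alpha> \<beta> \<gamma> c p a b "moment w"
  proof
    show "moment w (f + g) = moment w f + moment w g" for f g
      using suminf_add[OF summable summable] by (simp add: moment_def distrib_right)
    show "moment w (smult r f) = r * moment w f" for r f
      using suminf_mult[OF summable] by (simp add: moment_def mult.assoc)
    show "moment w ([:0, \<gamma> - 1, 1:] * f) = c * moment w ([:\<alpha>, 1:] * [:\<beta>, 1:] * shift 1 f)" for f
      using moment_pearson[OF pos summable[unfolded w_def]] by (simp add: w_def)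
    show "moment w (p n * p m) = (if m = n then 1 else 0)" for m n
      using orth unfolding orthonormal_polys_def moment_def by (simp add: sums_iff)
    show "degree (p n) = n" "lead_coeff (p n) > 0" for n
      using orth unfolding orthonormal_polys_def by blast+
  qed (use assms in auto)
  have phi: "(\<Sum>k. poly f (real k) * ((hg_potential \<alpha> \<beta> \<gamma> c (z + 1) - hg_potential \<alpha> \<beta> \<gamma> c (real k))
        / (z + 1 - real k)) * w k) = P.phi z f / ((z + \<alpha>) * (z + \<beta>))"
    if "z \<in> regular_points \<alpha> \<beta>" for f z
    unfolding P.phi_def
    by (rule sums_unique[OF difference_quotient_sums[OF pos summable[unfolded w_def] that,
      folded w_def], symmetric])
  have shift: "poly (p n) (real k) * poly q (real k - 1) = poly (p n * shift (-1) q) (real k)"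
    for n k q by (simp add: poly_shift)
  obtain z where z: "z \<in> regular_points \<alpha> \<beta>"
    using regular_point_exists[OF pos(1,2)] by blast
  then have nz: "(z + \<alpha>) * (z + \<beta>) \<noteq> 0"
    by (auto simp: regular_points_def add_eq_0_iff2)
  have x: "x n = P.X n" for n
    unfolding x_def hg_x_def
  proof (rule the_equality)
    have A: "ladder_A_over_a (hg_weight \<alpha> \<beta> \<gamma> c) (hg_potential \<alpha> \<beta> \<gamma> c) p n t
        = (1 - c) / c * ((t + P.X n) / ((t + \<alpha>) * (t + \<beta>)))" if "t \<in> regular_points \<alpha> \<beta>" for t
      unfolding ladder_A_over_a_def shift w_def[symmetric] phi[OF that] P.A_def[symmetric] P.A_eq
      by simp
    then show "\<forall>t\<in>regular_points \<alpha> \<beta>.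
        ladder_A_over_a (hg_weight \<alpha> \<beta> \<gamma> c) (hg_potential \<alpha> \<beta> \<gamma> c) p n t
        = (1 - c) / c * ((t + P.X n) / ((t + \<alpha>) * (t + \<beta>)))" by blast
    fix s
    assume "\<forall>t\<in>regular_points \<alpha> \<beta>.
        ladder_A_over_a (hg_weight \<alpha> \<beta> \<gamma> c) (hg_potential \<alpha> \<beta> \<gamma> c) p n t
        = (1 - c) / c * ((t + s) / ((t + \<alpha>) * (t + \<beta>)))"
    then have "(1 - c) / c * ((z + s) / ((z + \<alpha>) * (z + \<beta>)))
        = (1 - c) / c * ((z + P.X n) / ((z + \<alpha>) * (z + \<beta>)))"
      using A[OF z] z by simp
    then show "s = P.X n"
      using nz assms(4,5) by simp
  qed
  have y: "y n = P.Y n" for n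
    unfolding y_def hg_y_def
  proof (rule the_equality)
    have B: "ladder_B (hg_weight \<alpha> \<beta> \<gamma> c) (hg_potential \<alpha> \<beta> \<gamma> c) p a n t
        = (- real n * t + P.Y n) / ((t + \<alpha>) * (t + \<beta>))" if "t \<in> regular_points \<alpha> \<beta>" for t
      \<comment> \<open>For \<open>n = 0\<close> the default 0 agrees with
        \<open>prev 0 = 0\<close>; otherwise \<open>a n\<close> moves through \<open>phi\<close> by
        linearity.\<close>
      unfolding ladder_B_def shift w_def[symmetric] phi[OF that] P.B_eq[symmetric] P.B_def P.prev_def
      by (simp add: pcompose_smult P.phi_smult)
    then show "\<forall>t\<in>regular_points \<alpha> \<beta>.
        ladder_B (hg_weight \<alpha> \<beta> \<gamma> c) (hg_potential \<alpha> \<beta> \<gamma> c) p a n t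
        = (- real n * t + P.Y n) / ((t + \<alpha>) * (t + \<beta>))" by blast
    fix s
    assume "\<forall>t\<in>regular_points \<alpha> \<beta>.
        ladder_B (hg_weight \<alpha> \<beta> \<gamma> c) (hg_potential \<alpha> \<beta> \<gamma> c) p a n t
        = (- real n * t + s) / ((t + \<alpha>) * (t + \<beta>))"
    then have "(- real n * z + s) / ((z + \<alpha>) * (z + \<beta>))
        = (- real n * z + P.Y n) / ((z + \<alpha>) * (z + \<beta>))"
      using B[OF z] z by simp
    then show "s = P.Y n"
      using nz by simp
  qed
  have "(x n + Y n) * (x (n - 1) + Y n)
      = (y n + real n * \<alpha>) * (y n + real n * \<beta>)
        * (y n + real n * \<gamma> - (\<gamma> - \<alpha>) * (\<gamma> - \<beta>))
        * (y n + real n - (1 - \<alpha>) * (1 - \<beta>))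
        / (Y_den \<alpha> \<beta> \<gamma> n (y n))\<^sup>2"
    if "n \<ge> 1" and D: "Y_den \<alpha> \<beta> \<gamma> n (y n) \<noteq> 0" for n
  proof -
    have n: "Suc (n - 1) = n" using that by simp
    let ?D = "Y_den \<alpha> \<beta> \<gamma> n (y n)" and ?N = "Y_num \<alpha> \<beta> \<gamma> n (y n)"
    have "(x n + Y n) * (x (n - 1) + Y n) = (?D * x n + ?N) * (?D * x (n - 1) + ?N) / ?D\<^sup>2"
      using D by (simp add: Y_def field_simps power2_eq_square)
    then show ?thesis
      using P.second_equation[of "n - 1"] unfolding n x y by simp
  qed
  moreover have "y 0 = 0"
    unfolding y P.Y_def P.B_def by simp
  moreover have "x 0 = c * \<alpha> * \<beta> / \<gamma>
              * (hyp2F1 (\<alpha> + 1) (\<beta> + 1) (\<gamma> + 1) c / hyp2F1 \<alpha> \<beta> \<gamma> c)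
            - ((\<alpha> + \<beta>) * c - \<gamma>) / (1 - c)"
  proof -
    let ?L = "moment w"
    obtain r where r: "p 0 = [:r:]"
      using P.degree_p[of 0] degree_0_id by metis
    have L1: "?L 1 = hyp2F1 \<alpha> \<beta> \<gamma> c"
      by (simp add: moment_def w_def hg_weight_def hyp2F1_def)
    have "(\<lambda>k. real k * w k) sums (?L [:0, 1:])"
      using moment_sums[OF pos summable[unfolded w_def], of "[:0, 1:]"] by (simp add: w_def)
    then have "(\<lambda>k. real (Suc k) * w (Suc k)) sums (?L [:0, 1:])"
      using sums_Suc_iff[of "\<lambda>k. real k * w k" "?L [:0, 1:]"] by simp
    \<comment> \<open>\<open>Suc k\<close> cancels in the factorial, and splitting off the first
      Pochhammer factors raises every parameter by 1.\<close>
    moreover have "real (Suc k) * w (Suc k) = c * \<alpha> * \<beta> / \<gamma> * hg_weight (\<alpha> + 1) (\<beta> + 1) (\<gamma> + 1) c k"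
      for k
      using pos by (simp add: w_def hg_weight_def pochhammer_rec divide_simps)
    ultimately have "(\<lambda>k. c * \<alpha> * \<beta> / \<gamma> * hg_weight (\<alpha> + 1) (\<beta> + 1) (\<gamma> + 1) c k) sums (?L [:0, 1:])"
      by simp
    from sums_mult_D[OF this]
    have "(\<lambda>k. hg_weight (\<alpha> + 1) (\<beta> + 1) (\<gamma> + 1) c k) sums (?L [:0, 1:] / (c * \<alpha> * \<beta> / \<gamma>))"
      using pos by simp
    then have "hyp2F1 (\<alpha> + 1) (\<beta> + 1) (\<gamma> + 1) c = ?L [:0, 1:] / (c * \<alpha> * \<beta> / \<gamma>)"
      unfolding hyp2F1_def hg_weight_def by (rule sums_unique[symmetric])
    then have LX: "?L [:0, 1:] = c * \<alpha> * \<beta> / \<gamma> * hyp2F1 (\<alpha> + 1) (\<beta> + 1) (\<gamma> + 1) c"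
      using pos by simp
    have "p 0 * p 0 = smult (r * r) 1" by (simp add: r)
    then have rr: "r * r * ?L 1 = 1"
      using P.orth[of 0 0] P.L_smult[of "r * r" 1] by simp
    then have nz': "?L 1 \<noteq> 0" by auto
    have lin: "?L [:s, 1:] = s * ?L 1 + ?L [:0, 1:]" for s
      using P.L_add[of "smult s 1" "[:0, 1:]"] P.L_smult[of s 1] by simp
    \<comment> \<open>\<open>p 0\<close> is the constant \<open>r\<close>, so it equals its back
      shift and \<open>A 0 0\<close> is \<open>r * r\<close> times \<open>phi 0 1\<close>.\<close>
    have "P.A 0 0 = r * r * (?L [:\<gamma>, 1:] / c - ?L [:\<alpha> + \<beta>, 1:])"
      using P.phi_smult[of 0 "r * r" 1]
      by (simp add: P.A_def r P.phi_def pcompose_1 one_pCons)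
    also have "\<dots> = (r * r * ?L 1) * (\<gamma> / c - (\<alpha> + \<beta>)) + r * r * ?L [:0, 1:] * (1 / c - 1)"
      unfolding lin[of \<gamma>] lin[of "\<alpha> + \<beta>"] by (simp add: algebra_simps add_divide_distrib)
    also have "r * r = 1 / ?L 1"
      using rr by (intro eq_divide_imp) auto
    finally have "P.A 0 0 = \<gamma> / c - (\<alpha> + \<beta>) + ?L [:0, 1:] / ?L 1 * (1 / c - 1)"
      using nz' by simp
    then have "x 0 = ?L [:0, 1:] / ?L 1 - ((\<alpha> + \<beta>) * c - \<gamma>) / (1 - c)"
      using assms(4,5) unfolding x P.X_def by (simp add: divide_simps) (simp add: algebra_simps)
    then show ?thesis unfolding LX L1 by simp
  qed
  ultimately show ?thesis
    using P.first_equation unfolding x y by blast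
qed

end
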